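(* Let $C$ be an $A$-coring which is locally projective as a left $A$-module, let $B\to A$ be a ring morphism and $I$ any index set. Let $j=(j_\ell)_{\ell\in I}\in{}_A\mathrm{Hom}_{{}^*C}(C,({}^*C)^{I})$, let $\tilde\jmath\in{}_{C^*}\mathrm{Hom}_A(C^{(I)},C^* )$ be the corresponding element, given by $\tilde\jmath((c_\ell)_\ell)(d)=\sum_\ell j_\ell(d)(c_\ell)$, and let $\tilde\jmath':(C^{(I)})^B\to(C^* )^B$ be the restriction of $\tilde\jmath$. Then the following statements are equivalent: (i) for all $c_1,\dots,c_n\in C$ and $f\in(C^* )^B$ there exists $g\in\mathrm{Im}\,\tilde\jmath'$ such that $g(c_i)=f(c_i)$ for all $i$ (i.e. $\mathrm{Im}\,\tilde\jmath'$ is dense in the finite topology on $(C^* )^B$); (ii) for all $c_1,\dots,c_n\in C$ there exists $e\in\mathrm{Im}\,\tilde\jmath'$ such that $e(c_i)=\varepsilon(c_i)$ for all $i$; (iii) for all $c_1,\dots,c_n\in C$ and $f\in(C^* )^B$ there exists $g\in\mathrm{Im}\,\tilde\jmath'$ such that $f\cdot c_i=g\cdot c_i$ for all $i$ (i.e. $\mathrm{Im}\,\tilde\jmath'$ is dense in the $C$-adic topology on $(C^* )^B$); (iv) for all $c_1,\dots,c_n\in C$ there exists $e\in\mathrm{Im}\,\tilde\jmath'$ such that $e\cdot c_i=c_i$ for all $i$; (v) there exist $B$-linear local right inverses for $\tilde\jmath$, i.e. for all $c_1,\dots,c_n\in C$ there exists $\bar\jmath\in{}_{C^*}\mathrm{Hom}_B(C^*,C^{(I)})$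 such that $\tilde\jmath(\bar\jmath(f))(c_i)=f(c_i)$ for all $f\in C^*$ and all $i$; (vi) for all $c_1,\dots,c_n\in C$ there exists $\bar z=(z_\ell)\in(C^B)^{(I)}$ such that $c_i=\bar z\cdot j(c_i)=\sum_\ell z_\ell\cdot j_\ell(c_i)$ for all $i=1,\dots,n$. Moreover, if any of these conditions is satisfied, then: (a) there exist $B$-linear local left inverses for $j$, i.e. for all $c_1,\dots,c_n\in C$ there exists $\bar\jmath\in{}_B\mathrm{Hom}_{{}^*C}(({}^*C)^{I},C)$ such that $c_i=\bar\jmath(j(c_i))$ for all $i$; (b) $j$ is injective; (c) $C$ is $\mathrm{Im}\,\tilde\jmath$-locally projective as a right $A$-module.
   Context: $k$ is a commutative ring, $A$ a unital $k$-algebra. An $A$-coring $(C,\Delta,\varepsilon)$ is a coalgebra in the monoidal category of $A$-bimodules; $\Delta(c)=c_{(1)}\otimes_A c_{(2)}$. $C^*=\mathrm{Hom}_A(C,A)$ (right $A$-linear maps) is a ring with product $(f*g)(c)=f(g(c_{(1)})c_{(2)})$, and ${}^*C={}_A\mathrm{Hom}(C,A)$ (left $A$-linear maps) is a ring with product $(f*g)(c)=g(c_{(1)}f(c_{(2)}))$; both have unit $\varepsilon$, and $A$-bimodule structures $(afb)(c)=af(bc)$ on $C^*$ and $(afb)(c)=f(ca)b$ on ${}^*C$. $C$ is a left $C^*$-module by $f\cdot c=f(c_{(1)})c_{(2)}$ and a right ${}^*C$-module by $c\cdot f=c_{(1)}f(c_{(2)})$. $X^{(I)}$ and $X^I$ are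 the direct sum and product of copies of $X$. $A$-modules are $B$-modules via $B\to A$; for a $B$-bimodule $M$, $M^B=\{m\in M\mid bm=mb\ \forall b\in B\}$. ${}_R\mathrm{Hom}_S$ denotes bimodule maps. For a right $A$-module $M$ and an additive subset $\mathcal R\subset\mathrm{Hom}_A(M,A)$, $M$ is $\mathcal R$-locally projective if for every finite $N\subset M$ there are finitely many $e_i\in M$, $f_i\in\mathcal R$ with $n=\sum_i e_if_i(n)$ for all $n\in N$. Left modules are treated symmetrically, and "locally projective" means locally projective with respect to the full dual. *)

theory Defs
  imports "HOL-Library.Multiset" "HOL-Library.Function_Algebras"
begin

text \<open>
  Unital rings are types of sort \<open>{ring, monoid_mult}\<close> rather than \<open>ring_1\<close>: the class \<open>ring_1\<close>
  would exclude the zero ring.  Abelian groups of functions carry the pointwise structure of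
  \<^theory>\<open>HOL-Library.Function_Algebras\<close>.
\<close>

section \<open>Rings, bimodules and tensor products\<close>

locale ring_morphism =
  fixes \<phi> :: "'b::{ring,monoid_mult} \<Rightarrow> 'a::{ring,monoid_mult}"
  assumes map_add: "\<phi> (x + y) = \<phi> x + \<phi> y"
    and map_mult: "\<phi> (x * y) = \<phi> x * \<phi> y"
    and map_one: "\<phi> 1 = 1"

locale unital_algebra = ring_morphism \<iota>
  for \<iota> :: "'k::{comm_ring,monoid_mult} \<Rightarrow> 'a::{ring,monoid_mult}" +
  assumes central: "\<iota> t * a = a * \<iota> t"

text \<open>Bimodules over a \<open>k\<close>-algebra: the two induced actions of \<open>k\<close> agree.\<close>

locale bimodule = unital_algebra \<iota>
  for \<iota> :: "'k::{comm_ring,monoid_mult} \<Rightarrow> 'a::{ring,monoid_mult}" +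
  fixes l :: "'a \<Rightarrow> 'c::ab_group_add \<Rightarrow> 'c" and r :: "'c \<Rightarrow> 'a \<Rightarrow> 'c"
  assumes l_add_right: "l a (x + y) = l a x + l a y"
    and l_add_left: "l (a + b) x = l a x + l b x"
    and l_mult: "l (a * b) x = l a (l b x)"
    and l_one: "l 1 x = x"
    and r_add_left: "r (x + y) a = r x a + r y a"
    and r_add_right: "r x (a + b) = r x a + r x b"
    and r_mult: "r x (a * b) = r (r x a) b"
    and r_one: "r x 1 = x"
    and l_r: "r (l a x) b = l a (r x b)"
    and k_central: "l (\<iota> t) x = r x (\<iota> t)"

text \<open>
  \<open>M \<otimes>\<^sub>A N\<close> is built as the quotient of the free commutative monoid on \<open>M \<times> N\<close> (finite multisets,
  read as formal sums of elementary tensors) by the congruence generated by biadditivity and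
  \<open>A\<close>-balancedness.  This monoid is already a group, the inverse of the class of \<open>(m, n)\<close> being that
  of \<open>(- m, n)\<close>, so it agrees with the usual quotient of the free abelian group.
\<close>

inductive tensor_eq :: "('m::ab_group_add \<Rightarrow> 'a \<Rightarrow> 'm) \<Rightarrow> ('a \<Rightarrow> 'n::ab_group_add \<Rightarrow> 'n)
    \<Rightarrow> ('m \<times> 'n) multiset \<Rightarrow> ('m \<times> 'n) multiset \<Rightarrow> bool" for r l where
  refl: "tensor_eq r l S S"
| sym: "tensor_eq r l S T \<Longrightarrow> tensor_eq r l T S"
| trans: "tensor_eq r l S T \<Longrightarrow> tensor_eq r l T U \<Longrightarrow> tensor_eq r l S U"
| plus: "tensor_eq r l S T \<Longrightarrow> tensor_eq r l U V \<Longrightarrow> tensor_eq r l (S + U) (T + V)"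
| zero: "tensor_eq r l {#(0, n)#} {#}"
| add_left: "tensor_eq r l {#(m + m', n)#} {#(m, n), (m', n)#}"
| add_right: "tensor_eq r l {#(m, n + n')#} {#(m, n), (m, n')#}"
| balanced: "tensor_eq r l {#(r m a, n)#} {#(m, l a n)#}"

definition tensor :: "('m::ab_group_add \<Rightarrow> 'a \<Rightarrow> 'm) \<Rightarrow> ('a \<Rightarrow> 'n::ab_group_add \<Rightarrow> 'n)
    \<Rightarrow> ('m \<times> 'n) multiset set set" where
  "tensor r l = UNIV // {(S, T). tensor_eq r l S T}"

text \<open>Equality of formal sums in the threefold tensor product \<open>M \<otimes>\<^sub>A M \<otimes>\<^sub>A M\<close> of a bimodule.\<close>

inductive tensor3_eq :: "('a \<Rightarrow> 'm::ab_group_add \<Rightarrow> 'm) \<Rightarrow> ('m \<Rightarrow> 'a \<Rightarrow> 'm)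
    \<Rightarrow> ('m \<times> 'm \<times> 'm) multiset \<Rightarrow> ('m \<times> 'm \<times> 'm) multiset \<Rightarrow> bool" for l r where
  refl: "tensor3_eq l r S S"
| sym: "tensor3_eq l r S T \<Longrightarrow> tensor3_eq l r T S"
| trans: "tensor3_eq l r S T \<Longrightarrow> tensor3_eq l r T U \<Longrightarrow> tensor3_eq l r S U"
| plus: "tensor3_eq l r S T \<Longrightarrow> tensor3_eq l r U V \<Longrightarrow> tensor3_eq l r (S + U) (T + V)"
| zero: "tensor3_eq l r {#(0, y, z)#} {#}"
| add1: "tensor3_eq l r {#(x + x', y, z)#} {#(x, y, z), (x', y, z)#}"
| add2: "tensor3_eq l r {#(x, y + y', z)#} {#(x, y, z), (x, y', z)#}"
| add3: "tensor3_eq l r {#(x, y, z + z')#} {#(x, y, z), (x, y, z')#}"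
| balanced1: "tensor3_eq l r {#(r x a, y, z)#} {#(x, l a y, z)#}"
| balanced2: "tensor3_eq l r {#(x, r y a, z)#} {#(x, y, l a z)#}"


section \<open>Corings\<close>

record ('a, 'c) coring_data =
  lact :: "'a \<Rightarrow> 'c \<Rightarrow> 'c"
  ract :: "'c \<Rightarrow> 'a \<Rightarrow> 'c"
  comult :: "'c \<Rightarrow> ('c \<times> 'c) multiset set"
  counit :: "'c \<Rightarrow> 'a"

text \<open>
  The value \<open>comult C c\<close> is an equivalence class, so \<open>S \<in> comult C c\<close> says that
  \<open>\<Delta>(c) = \<Sum>\<^bsub>(x, y) \<in># S\<^esub> x \<otimes>\<^sub>A y\<close>.  In the coassociativity axiom \<open>D\<close> chooses representatives of
  the values of \<open>\<Delta>\<close>.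
\<close>

locale coring = bimodule \<iota> "lact C" "ract C"
  for \<iota> :: "'k::{comm_ring,monoid_mult} \<Rightarrow> 'a::{ring,monoid_mult}"
    and C :: "('a, 'c::ab_group_add) coring_data" +
  assumes comult_tensor: "comult C c \<in> tensor (ract C) (lact C)"
    and comult_add: "S \<in> comult C c \<Longrightarrow> T \<in> comult C d \<Longrightarrow> S + T \<in> comult C (c + d)"
    and comult_lact:
      "S \<in> comult C c \<Longrightarrow> image_mset (\<lambda>(x, y). (lact C a x, y)) S \<in> comult C (lact C a c)"
    and comult_ract:
      "S \<in> comult C c \<Longrightarrow> image_mset (\<lambda>(x, y). (x, ract C y a)) S \<in> comult C (ract C c a)"
    and counit_add: "counit C (c + d) = counit C c + counit C d"
    and counit_lact: "counit C (lact C a c) = a * counit C c"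
    and counit_ract: "counit C (ract C c a) = counit C c * a"
    and coassoc: "S \<in> comult C c \<Longrightarrow> (\<And>x. D x \<in> comult C x) \<Longrightarrow>
      tensor3_eq (lact C) (ract C)
        (\<Sum>(x, y)\<in>#S. image_mset (\<lambda>(u, v). (u, v, y)) (D x))
        (\<Sum>(x, y)\<in>#S. image_mset (\<lambda>(u, v). (x, u, v)) (D y))"
    and counit_left: "S \<in> comult C c \<Longrightarrow> (\<Sum>(x, y)\<in>#S. lact C (counit C x) y) = c"
    and counit_right: "S \<in> comult C c \<Longrightarrow> (\<Sum>(x, y)\<in>#S. ract C x (counit C y)) = c"

text \<open>
  \<open>sweedler C p c\<close> is \<open>p(c\<^sub>(\<^sub>1\<^sub>), c\<^sub>(\<^sub>2\<^sub>))\<close>.  It is used for biadditive balanced maps \<open>p\<close> only; for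
  these the representative chosen is irrelevant (lemma \<open>sweedler_eq\<close> below).
\<close>

definition sweedler :: "('a, 'c) coring_data \<Rightarrow> ('c \<Rightarrow> 'c \<Rightarrow> 'm::comm_monoid_add) \<Rightarrow> 'c \<Rightarrow> 'm" where
  "sweedler C p c = (\<Sum>(x, y)\<in>#(SOME S. S \<in> comult C c). p x y)"

lemma tensor_eq_sum:
  fixes p :: "'m::ab_group_add \<Rightarrow> 'n::ab_group_add \<Rightarrow> 'z::ab_group_add"
  assumes "tensor_eq r l S T"
    and add_left: "\<And>x x' y. p (x + x') y = p x y + p x' y"
    and add_right: "\<And>x y y'. p x (y + y') = p x y + p x y'"
    and balanced: "\<And>x a y. p (r x a) y = p x (l a y)"
  shows "(\<Sum>(x, y)\<in>#S. p x y) = (\<Sum>(x, y)\<in>#T. p x y)"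
  using assms(1)
proof induction
  case (zero n)
  have "p 0 n = 0" using add_left[of 0 0 n] by simp
  then show ?case by simp
qed (simp_all add: add_left add_right balanced)

lemma (in coring) sweedler_eq:
  fixes p :: "'c \<Rightarrow> 'c \<Rightarrow> 'z::ab_group_add"
  assumes S: "S \<in> comult C c"
    and "\<And>x x' y. p (x + x') y = p x y + p x' y"
    and "\<And>x y y'. p x (y + y') = p x y + p x y'"
    and "\<And>x a y. p (ract C x a) y = p x (lact C a y)"
  shows "sweedler C p c = (\<Sum>(x, y)\<in>#S. p x y)"
proof -
  obtain U where U: "comult C c = {(S, T). tensor_eq (ract C) (lact C) S T} `` {U}"
    using comult_tensor[of c] by (auto simp: tensor_def quotient_def)
  have "(SOME S. S \<in> comult C c) \<in> comult C c" using S by (rule someI)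
  then have "tensor_eq (ract C) (lact C) (SOME S. S \<in> comult C c) S"
    using S U by (metis (mono_tags, lifting) Image_singleton_iff case_prodD mem_Collect_eq
        tensor_eq.sym tensor_eq.trans)
  then show ?thesis unfolding sweedler_def by (rule tensor_eq_sum) (use assms in auto)
qed


section \<open>Dual rings and their actions\<close>

text \<open>\<open>rdual C\<close> is \<open>C\<^sup>*\<close> (right linear maps) and \<open>ldual C\<close> is \<open>\<^sup>*C\<close> (left linear maps).\<close>

definition rdual :: "('a::ring, 'c::ab_group_add) coring_data \<Rightarrow> ('c \<Rightarrow> 'a) set" where
  "rdual C = {f. (\<forall>x y. f (x + y) = f x + f y) \<and> (\<forall>x a. f (ract C x a) = f x * a)}"

definition ldual :: "('a::ring, 'c::ab_group_add) coring_data \<Rightarrow> ('c \<Rightarrow> 'a) set" where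
  "ldual C = {f. (\<forall>x y. f (x + y) = f x + f y) \<and> (\<forall>x a. f (lact C a x) = a * f x)}"

definition rdual_mult :: "('a::ring, 'c) coring_data \<Rightarrow> ('c \<Rightarrow> 'a) \<Rightarrow> ('c \<Rightarrow> 'a) \<Rightarrow> 'c \<Rightarrow> 'a" where
  "rdual_mult C f g = (\<lambda>c. sweedler C (\<lambda>x y. f (lact C (g x) y)) c)"

definition ldual_mult :: "('a::ring, 'c) coring_data \<Rightarrow> ('c \<Rightarrow> 'a) \<Rightarrow> ('c \<Rightarrow> 'a) \<Rightarrow> 'c \<Rightarrow> 'a" where
  "ldual_mult C f g = (\<lambda>c. sweedler C (\<lambda>x y. g (ract C x (f y))) c)"

definition rdual_lact :: "'a::ring \<Rightarrow> ('c \<Rightarrow> 'a) \<Rightarrow> 'c \<Rightarrow> 'a" where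
  "rdual_lact a f = (\<lambda>c. a * f c)"

definition rdual_ract :: "('a::ring, 'c) coring_data \<Rightarrow> ('c \<Rightarrow> 'a) \<Rightarrow> 'a \<Rightarrow> 'c \<Rightarrow> 'a" where
  "rdual_ract C f b = (\<lambda>c. f (lact C b c))"

definition ldual_lact :: "('a::ring, 'c) coring_data \<Rightarrow> 'a \<Rightarrow> ('c \<Rightarrow> 'a) \<Rightarrow> 'c \<Rightarrow> 'a" where
  "ldual_lact C a f = (\<lambda>c. f (ract C c a))"

text \<open>\<open>rdual_act C f c = f \<cdot> c\<close> for \<open>f \<in> C\<^sup>*\<close>, and \<open>ldual_act C c f = c \<cdot> f\<close> for \<open>f \<in> \<^sup>*C\<close>.\<close>

definition rdual_act :: "('a, 'c::ab_group_add) coring_data \<Rightarrow> ('c \<Rightarrow> 'a) \<Rightarrow> 'c \<Rightarrow> 'c" where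
  "rdual_act C f c = sweedler C (\<lambda>x y. lact C (f x) y) c"

definition ldual_act :: "('a, 'c::ab_group_add) coring_data \<Rightarrow> 'c \<Rightarrow> ('c \<Rightarrow> 'a) \<Rightarrow> 'c" where
  "ldual_act C c f = sweedler C (\<lambda>x y. ract C x (f y)) c"


section \<open>Local projectivity\<close>

definition right_locally_projective ::
    "('m::ab_group_add \<Rightarrow> 'a \<Rightarrow> 'm) \<Rightarrow> ('m \<Rightarrow> 'a) set \<Rightarrow> bool" where
  "right_locally_projective r R \<longleftrightarrow> (\<forall>N. finite N \<longrightarrow>
     (\<exists>(n::nat) e f. (\<forall>i<n. f i \<in> R) \<and> (\<forall>x\<in>N. x = (\<Sum>i<n. r (e i) (f i x)))))"

definition left_locally_projective ::
    "('a \<Rightarrow> 'm::ab_group_add \<Rightarrow> 'm) \<Rightarrow> ('m \<Rightarrow> 'a) set \<Rightarrow> bool" where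
  "left_locally_projective l R \<longleftrightarrow> (\<forall>N. finite N \<longrightarrow>
     (\<exists>(n::nat) e f. (\<forall>i<n. f i \<in> R) \<and> (\<forall>x\<in>N. x = (\<Sum>i<n. l (f i x) (e i)))))"


section \<open>Direct sums and products, invariants, bimodule maps\<close>

text \<open>Families indexed by the set \<open>I\<close> are functions that vanish outside \<open>I\<close>.\<close>

definition direct_product :: "'i set \<Rightarrow> 'm::zero set \<Rightarrow> ('i \<Rightarrow> 'm) set" where
  "direct_product I M = {z. (\<forall>i\<in>I. z i \<in> M) \<and> (\<forall>i. i \<notin> I \<longrightarrow> z i = 0)}"

definition direct_sum :: "'i set \<Rightarrow> 'm::zero set \<Rightarrow> ('i \<Rightarrow> 'm) set" where
  "direct_sum I M = {z \<in> direct_product I M. finite {i. z i \<noteq> 0}}"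

text \<open>\<open>M\<^sup>B\<close> for a \<open>B\<close>-bimodule whose actions are \<open>l\<close> and \<open>r\<close>.\<close>

definition invariants :: "('b \<Rightarrow> 'm \<Rightarrow> 'm) \<Rightarrow> ('m \<Rightarrow> 'b \<Rightarrow> 'm) \<Rightarrow> 'm set \<Rightarrow> 'm set" where
  "invariants l r M = {m \<in> M. \<forall>b. l b m = r m b}"

text \<open>
  \<open>bimodule_maps R S M lM rM N lN rN\<close> are the maps \<open>M \<rightarrow> N\<close> that are left \<open>R\<close>-linear for the
  actions \<open>lM\<close>, \<open>lN\<close> and right \<open>S\<close>-linear for \<open>rM\<close>, \<open>rN\<close>; their values outside \<open>M\<close> are
  unconstrained.
\<close>

definition bimodule_maps ::
    "'r set \<Rightarrow> 's set \<Rightarrow> 'm::plus set \<Rightarrow> ('r \<Rightarrow> 'm \<Rightarrow> 'm) \<Rightarrow> ('m \<Rightarrow> 's \<Rightarrow> 'm)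
     \<Rightarrow> 'n::plus set \<Rightarrow> ('r \<Rightarrow> 'n \<Rightarrow> 'n) \<Rightarrow> ('n \<Rightarrow> 's \<Rightarrow> 'n) \<Rightarrow> ('m \<Rightarrow> 'n) set" where
  "bimodule_maps R S M lM rM N lN rN = {h.
     (\<forall>x\<in>M. h x \<in> N) \<and>
     (\<forall>x\<in>M. \<forall>y\<in>M. h (x + y) = h x + h y) \<and>
     (\<forall>a\<in>R. \<forall>x\<in>M. h (lM a x) = lN a (h x)) \<and>
     (\<forall>b\<in>S. \<forall>x\<in>M. h (rM x b) = rN (h x) b)}"


section \<open>The maps attached to a family \<open>j\<close>\<close>

text \<open>\<open>\<^sub>AHom\<^bsub>*C\<^esub>(C, (\<^sup>*C)\<^sup>I)\<close>.\<close>

definition maps_into_power ::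
    "('a::ring, 'c::ab_group_add) coring_data \<Rightarrow> 'i set \<Rightarrow> ('c \<Rightarrow> 'i \<Rightarrow> 'c \<Rightarrow> 'a) set" where
  "maps_into_power C I = bimodule_maps UNIV (ldual C)
     UNIV (lact C) (ldual_act C)
     (direct_product I (ldual C)) (\<lambda>a h i. ldual_lact C a (h i)) (\<lambda>h g i. ldual_mult C (h i) g)"

text \<open>\<open>\<^sub>BHom\<^bsub>*C\<^esub>((\<^sup>*C)\<^sup>I, C)\<close>.\<close>

definition maps_from_power ::
    "('a::ring, 'c::ab_group_add) coring_data \<Rightarrow> ('b \<Rightarrow> 'a) \<Rightarrow> 'i set
     \<Rightarrow> (('i \<Rightarrow> 'c \<Rightarrow> 'a) \<Rightarrow> 'c) set" where
  "maps_from_power C \<phi> I = bimodule_maps UNIV (ldual C)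
     (direct_product I (ldual C)) (\<lambda>b h i. ldual_lact C (\<phi> b) (h i)) (\<lambda>h g i. ldual_mult C (h i) g)
     UNIV (\<lambda>b. lact C (\<phi> b)) (ldual_act C)"

text \<open>\<open>\<^bsub>C*\<^esub>Hom\<^sub>B(C\<^sup>*, C\<^bsup>(I)\<^esup>)\<close>.\<close>

definition maps_into_sum ::
    "('a::ring, 'c::ab_group_add) coring_data \<Rightarrow> ('b \<Rightarrow> 'a) \<Rightarrow> 'i set
     \<Rightarrow> (('c \<Rightarrow> 'a) \<Rightarrow> 'i \<Rightarrow> 'c) set" where
  "maps_into_sum C \<phi> I = bimodule_maps (rdual C) UNIV
     (rdual C) (rdual_mult C) (\<lambda>f b. rdual_ract C f (\<phi> b))
     (direct_sum I UNIV) (\<lambda>f z i. rdual_act C f (z i)) (\<lambda>z b i. ract C (z i) (\<phi> b))"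

definition j_tilde ::
    "'i set \<Rightarrow> ('c::zero \<Rightarrow> 'i \<Rightarrow> 'c \<Rightarrow> 'a::ring) \<Rightarrow> ('i \<Rightarrow> 'c) \<Rightarrow> 'c \<Rightarrow> 'a" where
  "j_tilde I j z = (\<lambda>d. \<Sum>i\<in>{i\<in>I. z i \<noteq> 0}. j d i (z i))"

text \<open>\<open>C\<^sup>B\<close>, \<open>(C\<^sup>*)\<^sup>B\<close> and \<open>(C\<^bsup>(I)\<^esup>)\<^sup>B\<close>.\<close>

definition coring_inv :: "('a, 'c) coring_data \<Rightarrow> ('b \<Rightarrow> 'a) \<Rightarrow> 'c set" where
  "coring_inv C \<phi> = invariants (\<lambda>b. lact C (\<phi> b)) (\<lambda>c b. ract C c (\<phi> b)) UNIV"

definition rdual_inv ::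
    "('a::ring, 'c::ab_group_add) coring_data \<Rightarrow> ('b \<Rightarrow> 'a) \<Rightarrow> ('c \<Rightarrow> 'a) set" where
  "rdual_inv C \<phi> = invariants (\<lambda>b. rdual_lact (\<phi> b)) (\<lambda>f b. rdual_ract C f (\<phi> b)) (rdual C)"

definition direct_sum_inv ::
    "('a, 'c::zero) coring_data \<Rightarrow> ('b \<Rightarrow> 'a) \<Rightarrow> 'i set \<Rightarrow> ('i \<Rightarrow> 'c) set" where
  "direct_sum_inv C \<phi> I = invariants
     (\<lambda>b z i. lact C (\<phi> b) (z i)) (\<lambda>z b i. ract C (z i) (\<phi> b)) (direct_sum I UNIV)"

text \<open>The image of the restriction of \<open>j_tilde I j\<close> to \<open>(C\<^bsup>(I)\<^esup>)\<^sup>B\<close>.\<close>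

definition im_j_tilde_inv ::
    "('a::ring, 'c::zero) coring_data \<Rightarrow> ('b \<Rightarrow> 'a) \<Rightarrow> 'i set
     \<Rightarrow> ('c \<Rightarrow> 'i \<Rightarrow> 'c \<Rightarrow> 'a) \<Rightarrow> ('c \<Rightarrow> 'a) set" where
  "im_j_tilde_inv C \<phi> I j = j_tilde I j ` direct_sum_inv C \<phi> I"

end

(*  The identity c \<cdot> j_l(d) = j_l(d_1)(c) d_2 says that e = j~(z) acts on C by
    e \<cdot> d = \<Sum>_l z_l \<cdot> j_l(d).  It holds after applying any g in *C, by *C-linearity of j, and *C
    separates the points of C because C is locally projective.  It makes j~ left C*-linear, so that
    f * e = j~(f \<cdot> z); if e acts as the identity on given elements, then f * e agrees with f on
    them.  Hence one invariant z with e \<cdot> c_i = c_i yields the density statements, and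
    f \<mapsto> f \<cdot> z and h \<mapsto> \<Sum>_l z_l \<cdot> h_l are the local inverses of j~ and j. *)
theory Submission
  imports Defs
begin

section \<open>Multiset sums, additive maps and separation by functionals\<close>

lemma sum_mset_sum_mset:
  "(\<Sum>t\<in>#(\<Sum>s\<in>#S. F s). p t) = (\<Sum>s\<in>#S. \<Sum>t\<in>#F s. p t)"
  by (induction S) auto

lemma sum_mset_sum:
  "(\<Sum>t\<in>#(\<Sum>s\<in>J. F s). p t) = (\<Sum>s\<in>J. \<Sum>t\<in>#F s. p t)"
  by (induction J rule: infinite_finite_induct) auto

lemma additive_zero:
  fixes h :: "'m::ab_group_add \<Rightarrow> 'n::ab_group_add"
  assumes "\<And>x y. h (x + y) = h x + h y"
  shows "h 0 = 0"
  using assms[of 0 0] by simp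

lemma additive_sum_mset:
  fixes h :: "'m::ab_group_add \<Rightarrow> 'n::ab_group_add"
  assumes "\<And>x y. h (x + y) = h x + h y"
  shows "h (\<Sum>s\<in>#S. p s) = (\<Sum>s\<in>#S. h (p s))"
  by (induction S) (auto simp: assms additive_zero[of h, OF assms])

lemma additive_sum:
  fixes h :: "'m::ab_group_add \<Rightarrow> 'n::ab_group_add"
  assumes "\<And>x y. h (x + y) = h x + h y"
  shows "h (\<Sum>s\<in>J. p s) = (\<Sum>s\<in>J. h (p s))"
  by (induction J rule: infinite_finite_induct) (auto simp: assms additive_zero[of h, OF assms])

text \<open>A map that is additive and balanced in all three slots turns each generating relation of
  the threefold tensor product into an identity.\<close>

lemma tensor3_eq_sum:
  fixes q :: "'m::ab_group_add \<Rightarrow> 'm \<Rightarrow> 'm \<Rightarrow> 'z::ab_group_add"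
  assumes "tensor3_eq l r S T"
    and add1: "\<And>x x' y z. q (x + x') y z = q x y z + q x' y z"
    and add2: "\<And>x y y' z. q x (y + y') z = q x y z + q x y' z"
    and add3: "\<And>x y z z'. q x y (z + z') = q x y z + q x y z'"
    and balanced1: "\<And>x a y z. q (r x a) y z = q x (l a y) z"
    and balanced2: "\<And>x a y z. q x (r y a) z = q x y (l a z)"
  shows "(\<Sum>(x, y, z)\<in>#S. q x y z) = (\<Sum>(x, y, z)\<in>#T. q x y z)"
  using assms(1)
proof induction
  case (zero y z)
  have "q 0 y z = 0" using add1[of 0 0 y z] by simp
  then show ?case by simp
qed (simp_all add: add1 add2 add3 balanced1 balanced2)

text \<open>These are the maps that factor through the tensor product of C with itself over A; for
  them the value of \<open>sweedler\<close> is independent of the representative.\<close>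

definition balanced :: "('a, 'c::ab_group_add) coring_data \<Rightarrow> ('c \<Rightarrow> 'c \<Rightarrow> 'z::ab_group_add) \<Rightarrow> bool"
  where "balanced C p \<longleftrightarrow> (\<forall>x x' y. p (x + x') y = p x y + p x' y) \<and>
    (\<forall>x y y'. p x (y + y') = p x y + p x y') \<and>
    (\<forall>x a y. p (ract C x a) y = p x (lact C a y))"

lemma rdualD:
  assumes "f \<in> rdual C"
  shows "f (x + y) = f x + f y" "f (ract C x a) = f x * a"
  using assms by (auto simp: rdual_def)

lemma ldualD:
  assumes "f \<in> ldual C"
  shows "f (x + y) = f x + f y" "f (lact C a x) = a * f x"
  using assms by (auto simp: ldual_def)

text \<open>A single system e_i, f_i expands both x and y, and the coefficients f_i(x) and f_i(y)
  coincide.\<close>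

lemma left_locally_projective_separates:
  assumes "left_locally_projective l R" and "\<And>g. g \<in> R \<Longrightarrow> g x = g y"
  shows "x = y"
proof -
  obtain n e f where f: "\<forall>i<(n::nat). f i \<in> R"
    and exp: "\<forall>w\<in>{x, y}. w = (\<Sum>i<n. l (f i w) (e i))"
    using assms(1)[unfolded left_locally_projective_def, rule_format, of "{x, y}"] by auto
  have "(\<Sum>i<n. l (f i x) (e i)) = (\<Sum>i<n. l (f i y) (e i))"
    by (rule sum.cong) (use f assms(2) in \<open>metis lessThan_iff\<close>)+
  with exp show ?thesis by auto
qed


section \<open>Sweedler notation\<close>

lemma sweedler_hom:
  fixes h :: "'m::ab_group_add \<Rightarrow> 'n::ab_group_add"
  assumes "\<And>x y. h (x + y) = h x + h y"
  shows "h (sweedler C p c) = sweedler C (\<lambda>x y. h (p x y)) c"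
  by (simp add: sweedler_def additive_sum_mset[of h, OF assms] case_prod_unfold)

lemma sweedler_plus:
  "sweedler C (\<lambda>x y. p x y + q x y) c = sweedler C p c + sweedler C q c"
  by (simp add: sweedler_def case_prod_unfold sum_mset.distrib)

lemma sweedler_cong:
  "(\<And>x y. p x y = q x y) \<Longrightarrow> sweedler C p c = sweedler C q c"
  by (simp add: sweedler_def)

context coring
begin

lemma l_zero [simp]: "lact C a 0 = 0" "lact C 0 x = 0"
  using l_add_right[of a 0 0] l_add_left[of 0 0 x] by auto

lemma r_zero [simp]: "ract C 0 a = 0" "ract C x 0 = 0"
  using r_add_left[of 0 0 a] r_add_right[of x 0 0] by auto

text \<open>An equivalence class contains its generator by reflexivity, so the choice made in
  \<open>sweedler\<close> picks an actual representative.\<close>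

lemma some_comult: "(SOME S. S \<in> comult C c) \<in> comult C c"
proof -
  obtain U where "comult C c = {(S, T). tensor_eq (ract C) (lact C) S T} `` {U}"
    using comult_tensor[of c] by (auto simp: tensor_def quotient_def)
  then have "U \<in> comult C c" by (auto intro: tensor_eq.refl)
  then show ?thesis by (rule someI)
qed

lemma sweedler_balanced:
  fixes p :: "'c \<Rightarrow> 'c \<Rightarrow> 'z::ab_group_add"
  assumes "balanced C p" "S \<in> comult C c"
  shows "sweedler C p c = (\<Sum>(x, y)\<in>#S. p x y)"
  using assms by (intro sweedler_eq) (auto simp: balanced_def)

text \<open>Adding the chosen representatives for c and d gives some representative for c + d,
  perhaps not the chosen one; balancedness makes the difference invisible.\<close>

lemma sweedler_add:
  fixes p :: "'c \<Rightarrow> 'c \<Rightarrow> 'z::ab_group_add"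
  assumes "balanced C p"
  shows "sweedler C p (c + d) = sweedler C p c + sweedler C p d"
  using sweedler_balanced[OF assms comult_add[OF some_comult some_comult], of c d]
  by (simp add: sweedler_def)

lemma sweedler_lact:
  fixes p :: "'c \<Rightarrow> 'c \<Rightarrow> 'z::ab_group_add"
  assumes "balanced C p"
  shows "sweedler C p (lact C a c) = sweedler C (\<lambda>x y. p (lact C a x) y) c"
  using sweedler_balanced[OF assms comult_lact[OF some_comult], of a c]
  by (simp add: sweedler_def case_prod_unfold image_mset.compositionality o_def)

lemma sweedler_ract:
  fixes p :: "'c \<Rightarrow> 'c \<Rightarrow> 'z::ab_group_add"
  assumes "balanced C p"
  shows "sweedler C p (ract C c a) = sweedler C (\<lambda>x y. p x (ract C y a)) c"
  using sweedler_balanced[OF assms comult_ract[OF some_comult], of c a]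
  by (simp add: sweedler_def case_prod_unfold image_mset.compositionality o_def)

text \<open>With the chosen representatives as \<open>D\<close> in \<open>coassoc\<close>, nested
  sums become sums of \<open>q\<close> over triples; the hypotheses make \<open>q\<close> well
  defined on the threefold tensor product.\<close>

lemma sweedler_coassoc:
  fixes q :: "'c \<Rightarrow> 'c \<Rightarrow> 'c \<Rightarrow> 'z::ab_group_add"
  assumes "\<And>x x' y z. q (x + x') y z = q x y z + q x' y z"
    and "\<And>x y y' z. q x (y + y') z = q x y z + q x y' z"
    and "\<And>x y z z'. q x y (z + z') = q x y z + q x y z'"
    and "\<And>x a y z. q (ract C x a) y z = q x (lact C a y) z"
    and "\<And>x a y z. q x (ract C y a) z = q x y (lact C a z)"
  shows "sweedler C (\<lambda>x y. sweedler C (\<lambda>u v. q u v y) x) c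
    = sweedler C (\<lambda>x y. sweedler C (\<lambda>u v. q x u v) y) c"
  using tensor3_eq_sum[OF coassoc[OF some_comult some_comult], of q c, OF assms]
  by (simp add: sweedler_def sum_mset_sum_mset case_prod_unfold image_mset.compositionality o_def)

lemma sweedler_counit_left: "sweedler C (\<lambda>x y. lact C (counit C x) y) c = c"
  using counit_left[OF some_comult] by (simp add: sweedler_def)

lemma sweedler_counit_right: "sweedler C (\<lambda>x y. ract C x (counit C y)) c = c"
  using counit_right[OF some_comult] by (simp add: sweedler_def)


section \<open>Dual rings and their actions\<close>

lemma counit_rdual: "counit C \<in> rdual C"
  by (simp add: rdual_def counit_add counit_ract)

lemma balanced_rdual_act:
  assumes "f \<in> rdual C"
  shows "balanced C (\<lambda>x y. lact C (f x) y)"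
  using assms by (simp add: balanced_def rdualD[OF assms] l_add_left l_add_right l_mult)

lemma balanced_ldual_act:
  assumes "f \<in> ldual C"
  shows "balanced C (\<lambda>x y. ract C x (f y))"
  using assms by (simp add: balanced_def ldualD[OF assms] r_add_left r_add_right r_mult)

lemma rdual_act_add:
  "f \<in> rdual C \<Longrightarrow> rdual_act C f (c + d) = rdual_act C f c + rdual_act C f d"
  unfolding rdual_act_def by (rule sweedler_add[OF balanced_rdual_act])

lemma rdual_act_zero: "f \<in> rdual C \<Longrightarrow> rdual_act C f 0 = 0"
  by (rule additive_zero) (rule rdual_act_add)

lemma rdual_act_ract:
  assumes "f \<in> rdual C"
  shows "rdual_act C f (ract C c a) = ract C (rdual_act C f c) a"
  unfolding rdual_act_def sweedler_ract[OF balanced_rdual_act[OF assms]]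
  by (subst sweedler_hom[of "\<lambda>x. ract C x a"]) (auto simp: r_add_left l_r)

lemma rdual_act_plus: "rdual_act C (f + g) c = rdual_act C f c + rdual_act C g c"
  by (simp add: rdual_act_def l_add_left sweedler_plus)

lemma rdual_act_rdual_ract:
  assumes "f \<in> rdual C"
  shows "rdual_act C (rdual_ract C f a) c = rdual_act C f (lact C a c)"
  by (simp add: rdual_act_def sweedler_lact[OF balanced_rdual_act[OF assms]] rdual_ract_def)

lemma rdual_act_rdual_lact: "rdual_act C (rdual_lact a f) c = lact C a (rdual_act C f c)"
  unfolding rdual_act_def rdual_lact_def l_mult
  by (rule sweedler_hom[of "lact C a", symmetric]) (rule l_add_right)

lemma rdual_act_counit: "rdual_act C (counit C) c = c"
  by (simp add: rdual_act_def sweedler_counit_left)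

text \<open>Additivity lets f pass through the Sweedler sum, so multiplication becomes evaluation
  after an action.\<close>

lemma rdual_mult_eq: "f \<in> rdual C \<Longrightarrow> rdual_mult C f g c = f (rdual_act C g c)"
  unfolding rdual_mult_def rdual_act_def
  by (subst sweedler_hom[of f]) (auto simp: rdualD)

text \<open>\<epsilon>(f(c_1) c_2) = f(c_1) \<epsilon>(c_2) = f(c_1 \<epsilon>(c_2)) = f(c). Thus f
  can be recovered from its action.\<close>

lemma counit_rdual_act:
  assumes "f \<in> rdual C"
  shows "counit C (rdual_act C f c) = f c"
proof -
  have "counit C (rdual_act C f c) = sweedler C (\<lambda>x y. f (ract C x (counit C y))) c"
    unfolding rdual_act_def
    by (subst sweedler_hom[of "counit C"])
      (auto simp: counit_add counit_lact rdualD[OF assms])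
  also have "\<dots> = f (sweedler C (\<lambda>x y. ract C x (counit C y)) c)"
    by (subst sweedler_hom[of f]) (auto simp: rdualD[OF assms])
  finally show ?thesis by (simp add: sweedler_counit_right)
qed

text \<open>Coassociativity applied to the balanced expression f(g(x) y) z.\<close>

lemma rdual_act_mult:
  assumes f: "f \<in> rdual C" and g: "g \<in> rdual C"
  shows "rdual_act C (rdual_mult C f g) c = rdual_act C f (rdual_act C g c)"
proof -
  have "rdual_act C (rdual_mult C f g) c
      = sweedler C (\<lambda>x y. sweedler C (\<lambda>u v. lact C (f (lact C (g u) v)) y) x) c"
    unfolding rdual_act_def rdual_mult_def
    by (intro sweedler_cong, subst sweedler_hom[of "\<lambda>a. lact C a _"]) (auto simp: l_add_left)
  also have "\<dots> = sweedler C (\<lambda>x y. sweedler C (\<lambda>u v. lact C (f (lact C (g x) u)) v) y) c"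
    by (rule sweedler_coassoc)
      (auto simp: rdualD[OF f] rdualD[OF g] l_add_left l_add_right l_mult l_r simp flip: l_r)
  also have "\<dots> = sweedler C (\<lambda>x y. rdual_act C f (lact C (g x) y)) c"
    by (simp add: rdual_act_def sweedler_lact[OF balanced_rdual_act[OF f]])
  also have "\<dots> = rdual_act C f (rdual_act C g c)"
    unfolding rdual_act_def[of C g]
    by (subst sweedler_hom[of "rdual_act C f"]) (auto simp: rdual_act_add f)
  finally show ?thesis .
qed

lemma rdual_lact_mem: "f \<in> rdual C \<Longrightarrow> rdual_lact a f \<in> rdual C"
  by (simp add: rdual_def rdual_lact_def distrib_left mult.assoc)

lemma rdual_mult_counit:
  assumes "f \<in> rdual C"
  shows "rdual_mult C f (counit C) = f"
  by (rule ext) (simp add: rdual_mult_eq[OF assms] rdual_act_counit)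

lemma counit_rdual_inv: "counit C \<in> rdual_inv C \<phi>"
  by (simp add: rdual_inv_def invariants_def counit_rdual rdual_lact_def rdual_ract_def counit_lact)

text \<open>The sum f(c_1) c_2 reads f only at the first legs of the chosen representative of
  \<open>comult C c\<close>. This is the passage from the finite topology to the C-adic one.\<close>

lemma rdual_act_finite_dependence:
  assumes "finite N"
  shows "\<exists>M. finite M \<and> (\<forall>f g. (\<forall>x\<in>M. f x = g x) \<longrightarrow>
    (\<forall>c\<in>N. rdual_act C f c = rdual_act C g c))"
proof -
  let ?M = "\<Union>c\<in>N. fst ` set_mset (SOME S. S \<in> comult C c)"
  have "rdual_act C f c = rdual_act C g c" if "\<forall>x\<in>?M. f x = g x" "c \<in> N" for f g c
    unfolding rdual_act_def sweedler_def case_prod_unfold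
    by (rule arg_cong[of _ _ sum_mset], rule image_mset_cong) (use that in fastforce)
  then show ?thesis using assms by (intro exI[of _ ?M]) auto
qed

section \<open>The left dual and its right action on the coring\<close>

lemma ldual_act_add:
  "f \<in> ldual C \<Longrightarrow> ldual_act C (c + d) f = ldual_act C c f + ldual_act C d f"
  unfolding ldual_act_def by (rule sweedler_add[OF balanced_ldual_act])

lemma ldual_act_plus: "ldual_act C c (f + g) = ldual_act C c f + ldual_act C c g"
  by (simp add: ldual_act_def r_add_right sweedler_plus)

lemma ldual_act_lact:
  assumes "f \<in> ldual C"
  shows "ldual_act C (lact C a c) f = lact C a (ldual_act C c f)"
  unfolding ldual_act_def sweedler_lact[OF balanced_ldual_act[OF assms]]
  by (subst sweedler_hom[of "lact C a"]) (auto simp: l_add_right l_r)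

lemma ldual_act_ldual_lact:
  assumes "f \<in> ldual C"
  shows "ldual_act C c (ldual_lact C a f) = ldual_act C (ract C c a) f"
  by (simp add: ldual_act_def sweedler_ract[OF balanced_ldual_act[OF assms]] ldual_lact_def)

lemma ldual_mult_eq: "g \<in> ldual C \<Longrightarrow> ldual_mult C f g c = g (ldual_act C c f)"
  unfolding ldual_mult_def ldual_act_def
  by (subst sweedler_hom[of g]) (auto simp: ldualD)

text \<open>Coassociativity, read from right to left, applied to x g(y f(z)).\<close>

lemma ldual_act_mult:
  assumes f: "f \<in> ldual C" and g: "g \<in> ldual C"
  shows "ldual_act C c (ldual_mult C f g) = ldual_act C (ldual_act C c f) g"
proof -
  have "ldual_act C c (ldual_mult C f g)
      = sweedler C (\<lambda>x y. sweedler C (\<lambda>u v. ract C x (g (ract C u (f v)))) y) c"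
    unfolding ldual_act_def ldual_mult_def
    by (intro sweedler_cong, subst sweedler_hom[of "ract C _"]) (auto simp: r_add_right)
  also have "\<dots> = sweedler C (\<lambda>x y. sweedler C (\<lambda>u v. ract C u (g (ract C v (f y)))) x) c"
    by (rule sweedler_coassoc[symmetric])
      (auto simp: ldualD[OF f] ldualD[OF g] r_add_left r_add_right r_mult l_r)
  also have "\<dots> = sweedler C (\<lambda>x y. ldual_act C (ract C x (f y)) g) c"
    by (simp add: ldual_act_def sweedler_ract[OF balanced_ldual_act[OF g]])
  also have "\<dots> = ldual_act C (ldual_act C c f) g"
    unfolding ldual_act_def[of C _ f]
    by (subst sweedler_hom[of "\<lambda>c. ldual_act C c g"]) (auto simp: ldual_act_add g)
  finally show ?thesis .
qed

text \<open>The embedding \<open>A \<rightarrow> \<^sup>*C\<close>, through which \<open>\<^sup>*C\<close>-linear maps are right \<open>A\<close>-linear.\<close>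

definition counit_times :: "'a \<Rightarrow> 'c \<Rightarrow> 'a" where
  "counit_times a = (\<lambda>c. counit C c * a)"

lemma counit_times_ldual: "counit_times a \<in> ldual C"
  by (simp add: counit_times_def ldual_def counit_add counit_lact distrib_right mult.assoc)

lemma ldual_act_counit_times: "ldual_act C c (counit_times a) = ract C c a"
  unfolding ldual_act_def counit_times_def r_mult
  using sweedler_hom[of "\<lambda>x. ract C x a" C "\<lambda>x y. ract C x (counit C y)" c]
  by (simp add: r_add_left sweedler_counit_right)

lemma counit_ldual_act:
  assumes "f \<in> ldual C"
  shows "counit C (ldual_act C c f) = f c"
proof -
  have "counit C (ldual_act C c f) = sweedler C (\<lambda>x y. f (lact C (counit C x) y)) c"
    unfolding ldual_act_def
    by (subst sweedler_hom[of "counit C"])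
      (auto simp: counit_add counit_ract ldualD[OF assms])
  also have "\<dots> = f (sweedler C (\<lambda>x y. lact C (counit C x) y) c)"
    by (subst sweedler_hom[of f]) (auto simp: ldualD[OF assms])
  finally show ?thesis by (simp add: sweedler_counit_left)
qed

lemma ldual_mult_counit_times:
  "f \<in> ldual C \<Longrightarrow> ldual_mult C f (counit_times a) = (\<lambda>c. f c * a)"
  by (rule ext)
    (simp only: ldual_mult_eq[OF counit_times_ldual], simp add: counit_ldual_act counit_times_def)

text \<open>Both sides equal f(c_1) g(c_2), since scalars leave f on the right and g on the
  left.\<close>

lemma rdual_ldual_act:
  assumes f: "f \<in> rdual C" and g: "g \<in> ldual C"
  shows "f (ldual_act C c g) = g (rdual_act C f c)"
  unfolding rdual_act_def ldual_act_def
  by (subst sweedler_hom[of f], simp add: rdualD[OF f],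
      subst sweedler_hom[of g], simp add: ldualD[OF g])
    (simp add: rdualD[OF f] ldualD[OF g])

lemma ldual_act_expansion:
  "ldual_act C c f = (\<Sum>(x, y)\<in>#(SOME S. S \<in> comult C c). ract C x (f y))"
  by (simp add: ldual_act_def sweedler_def)

end


section \<open>The map \<open>j\<close>\<close>

locale coring_map_into_power = coring \<iota> C
  for \<iota> :: "'k::{comm_ring,monoid_mult} \<Rightarrow> 'a::{ring,monoid_mult}"
    and C :: "('a, 'c::ab_group_add) coring_data" +
  fixes I :: "'i set" and j :: "'c \<Rightarrow> 'i \<Rightarrow> 'c \<Rightarrow> 'a"
    and \<phi> :: "'b::{ring,monoid_mult} \<Rightarrow> 'a"
  assumes locally_projective: "left_locally_projective (lact C) (ldual C)"
    and j_mem: "j \<in> maps_into_power C I"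
begin

lemma j_ldual: "j c i \<in> ldual C"
proof (cases "i \<in> I")
  case False
  then have "j c i = 0"
    using j_mem by (auto simp: maps_into_power_def bimodule_maps_def direct_product_def)
  then show ?thesis by (simp add: ldual_def)
qed (use j_mem in \<open>auto simp: maps_into_power_def bimodule_maps_def direct_product_def\<close>)

lemma j_zero: "j c i 0 = 0"
  using ldualD(1)[OF j_ldual, of c i 0 0] by simp

lemma j_add: "j (c + d) i x = j c i x + j d i x"
  using j_mem by (auto simp: maps_into_power_def bimodule_maps_def)

lemma j_ldual_act: "g \<in> ldual C \<Longrightarrow> j (ldual_act C c g) i = ldual_mult C (j c i) g"
  using j_mem by (auto simp: maps_into_power_def bimodule_maps_def)

text \<open>The functional \<open>counit_times a\<close> acts on C as right multiplication by a, and
  multiplying a functional by it on the right multiplies the values by a; so linearity over the left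
  dual includes right A-linearity.\<close>

lemma j_ract: "j (ract C c a) i x = j c i x * a"
  using j_ldual_act[OF counit_times_ldual, of c a i]
  by (simp add: ldual_act_counit_times ldual_mult_counit_times[OF j_ldual])

lemma j_rdual: "(\<lambda>d. j d i c) \<in> rdual C"
  by (simp add: rdual_def j_add j_ract)

lemma ldual_act_j: "ldual_act C c (j d i) = rdual_act C (\<lambda>d. j d i c) d"
proof (rule left_locally_projective_separates[OF locally_projective])
  fix g assume g: "g \<in> ldual C"
  have "g (ldual_act C c (j d i)) = j (ldual_act C d g) i c"
    by (simp add: j_ldual_act g ldual_mult_eq)
  \<comment> \<open>The map d \<mapsto> j_i(d)(c) is right linear, so it can be exchanged with
    g.\<close>
  also have "\<dots> = g (rdual_act C (\<lambda>d. j d i c) d)"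
    using rdual_ldual_act[OF j_rdual g] .
  finally show "g (ldual_act C c (j d i)) = g (rdual_act C (\<lambda>d. j d i c) d)" .
qed

section \<open>The map j~ and the action of its values\<close>

lemma j_tilde_rdual: "j_tilde I j z \<in> rdual C"
  by (simp add: rdual_def j_tilde_def j_add j_ract sum.distrib sum_distrib_right)

text \<open>The action is additive in the functional, so \<open>ldual_act_j\<close> applies to each
  summand. This identifies condition (iv) with condition (vi).\<close>

lemma rdual_act_j_tilde:
  "rdual_act C (j_tilde I j z) c = (\<Sum>i\<in>{i\<in>I. z i \<noteq> 0}. ldual_act C (z i) (j c i))"
proof -
  have "rdual_act C (\<lambda>d. \<Sum>i\<in>J. j d i (z i)) c = (\<Sum>i\<in>J. rdual_act C (\<lambda>d. j d i (z i)) c)" for J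
  proof (induction J rule: infinite_finite_induct)
    case (insert i J)
    then show ?case
      using rdual_act_plus[of "\<lambda>d. j d i (z i)" "\<lambda>d. \<Sum>i\<in>J. j d i (z i)" c]
      by (simp add: plus_fun_def)
  qed (simp_all add: rdual_act_def sweedler_def case_prod_unfold)
  then show ?thesis by (simp add: j_tilde_def ldual_act_j)
qed

text \<open>Left linearity of j~ over the right dual in evaluated form: for e =
  \<open>j_tilde I j z\<close>, the right-hand side f(e \<cdot> c) is the value of f * e at
  c.\<close>

lemma j_tilde_rdual_act:
  assumes f: "f \<in> rdual C" and z: "finite {i. z i \<noteq> 0}"
  shows "j_tilde I j (\<lambda>i. rdual_act C f (z i)) c = f (rdual_act C (j_tilde I j z) c)"
proof -
  have "j_tilde I j (\<lambda>i. rdual_act C f (z i)) c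
      = (\<Sum>i\<in>{i\<in>I. z i \<noteq> 0}. j c i (rdual_act C f (z i)))"
    unfolding j_tilde_def
  \<comment> \<open>The support of f \<cdot> z may be smaller than that of z; the extra terms
    evaluate j_i(c) at 0 and vanish.\<close>
  proof (rule sum.mono_neutral_left)
    show "finite {i \<in> I. z i \<noteq> 0}" using z by simp
  qed (auto simp: rdual_act_zero f j_zero)
  also have "\<dots> = f (rdual_act C (j_tilde I j z) c)"
    unfolding rdual_act_j_tilde additive_sum[of f, OF rdualD(1)[OF f]]
    by (simp add: rdual_ldual_act[OF f j_ldual])
  finally show ?thesis .
qed

section \<open>Invariant families and local inverses\<close>

lemma direct_sum_inv_eq: "direct_sum_inv C \<phi> I = direct_sum I (coring_inv C \<phi>)"
proof -
  have "z i = 0 \<Longrightarrow> lact C (\<phi> b) (z i) = ract C (z i) (\<phi> b)" for z :: "'i \<Rightarrow> 'c" and i b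
    by simp
  then show ?thesis
    unfolding direct_sum_inv_def direct_sum_def direct_product_def coring_inv_def invariants_def
      fun_eq_iff
    by blast
qed

lemma direct_sum_invD:
  assumes "z \<in> direct_sum_inv C \<phi> I"
  shows "finite {i. z i \<noteq> 0}" "i \<notin> I \<Longrightarrow> z i = 0" "lact C (\<phi> b) (z i) = ract C (z i) (\<phi> b)"
  using assms
  by (auto simp: direct_sum_inv_def direct_sum_def direct_product_def invariants_def dest: fun_cong)

lemma rdual_act_direct_sum:
  assumes "f \<in> rdual C" "z \<in> direct_sum_inv C \<phi> I"
  shows "(\<lambda>i. rdual_act C f (z i)) \<in> direct_sum I UNIV"
proof -
  have "{i. rdual_act C f (z i) \<noteq> 0} \<subseteq> {i. z i \<noteq> 0}"
    by (auto simp: rdual_act_zero assms(1))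
  then show ?thesis
    using direct_sum_invD[OF assms(2)] finite_subset
    by (auto simp: direct_sum_def direct_product_def rdual_act_zero assms(1))
qed

text \<open>b(f \<cdot> z_i) = (bf) \<cdot> z_i = (fb) \<cdot> z_i = f \<cdot> (b z_i) = f \<cdot>
  (z_i b) = (f \<cdot> z_i) b.\<close>

lemma rdual_act_direct_sum_inv:
  assumes f: "f \<in> rdual_inv C \<phi>" and z: "z \<in> direct_sum_inv C \<phi> I"
  shows "(\<lambda>i. rdual_act C f (z i)) \<in> direct_sum_inv C \<phi> I"
proof -
  have f': "f \<in> rdual C" "rdual_lact (\<phi> b) f = rdual_ract C f (\<phi> b)" for b
    using f by (auto simp: rdual_inv_def invariants_def)
  have "lact C (\<phi> b) (rdual_act C f (z i)) = ract C (rdual_act C f (z i)) (\<phi> b)" for b i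
    by (metis f' direct_sum_invD(3)[OF z] rdual_act_rdual_lact rdual_act_rdual_ract rdual_act_ract)
  then show ?thesis
    unfolding direct_sum_inv_def invariants_def using rdual_act_direct_sum[OF f'(1) z] by simp
qed

text \<open>Left linearity over the right dual is \<open>rdual_act_mult\<close>; over B, (fb)
  \<cdot> z_i = f \<cdot> (b z_i) = f \<cdot> (z_i b) = (f \<cdot> z_i) b.\<close>

lemma local_right_inverse_mem:
  assumes z: "z \<in> direct_sum_inv C \<phi> I"
  shows "(\<lambda>f i. rdual_act C f (z i)) \<in> maps_into_sum C \<phi> I"
  unfolding maps_into_sum_def bimodule_maps_def
  by (auto simp: rdual_act_direct_sum[OF _ z] rdual_act_plus rdual_act_mult rdual_act_rdual_ract
      rdual_act_ract direct_sum_invD(3)[OF z])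

text \<open>Since b \<epsilon> = \<epsilon> b, computing h of this functional in two ways gives b
  h(\<epsilon>) and h(\<epsilon>) b.\<close>

lemma invariant_of_map_into_sum:
  assumes h: "h \<in> maps_into_sum C \<phi> I"
  shows "h (counit C) \<in> direct_sum_inv C \<phi> I"
proof -
  have "lact C (\<phi> b) (h (counit C) i) = ract C (h (counit C) i) (\<phi> b)" for b i
  proof -
    let ?e = "rdual_lact (\<phi> b) (counit C)"
    have e: "?e \<in> rdual C" by (rule rdual_lact_mem[OF counit_rdual])
    \<comment> \<open>The functional \<open>?e\<close> is written as its product with the unit
      \<epsilon>, to which left linearity of h applies.\<close>
    have "h ?e i = rdual_act C ?e (h (counit C) i)"
      using h e counit_rdual rdual_mult_counit[OF e]
      unfolding maps_into_sum_def bimodule_maps_def by force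
    also have "\<dots> = lact C (\<phi> b) (h (counit C) i)"
      by (simp add: rdual_act_rdual_lact rdual_act_counit)
    finally have "h ?e i = lact C (\<phi> b) (h (counit C) i)" .
    moreover have "?e = rdual_ract C (counit C) (\<phi> b)"
      by (simp add: rdual_lact_def rdual_ract_def counit_lact)
    moreover have "h (rdual_ract C (counit C) (\<phi> b)) i = ract C (h (counit C) i) (\<phi> b)"
      using h counit_rdual unfolding maps_into_sum_def bimodule_maps_def by force
    ultimately show ?thesis by simp
  qed
  moreover have "h (counit C) \<in> direct_sum I UNIV"
    using h counit_rdual unfolding maps_into_sum_def bimodule_maps_def by blast
  ultimately show ?thesis by (simp add: direct_sum_inv_def invariants_def)
qed

text \<open>Over B, z_i \<cdot> (b h_i) = (z_i b) \<cdot> h_i = (b z_i) \<cdot> h_i = b (z_i \<cdot>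
  h_i). Linearity over the left dual is \<open>ldual_act_mult\<close> in each term.\<close>

lemma local_left_inverse_mem:
  assumes z: "z \<in> direct_sum_inv C \<phi> I"
  shows "(\<lambda>h. \<Sum>i\<in>{i\<in>I. z i \<noteq> 0}. ldual_act C (z i) (h i)) \<in> maps_from_power C \<phi> I"
proof -
  have mem: "h i \<in> ldual C" if "h \<in> direct_product I (ldual C)" for h i
    using that by (cases "i \<in> I") (auto simp: direct_product_def ldual_def)
  have lact: "ldual_act C (z i) (ldual_lact C (\<phi> b) f) = lact C (\<phi> b) (ldual_act C (z i) f)"
    if "f \<in> ldual C" for f b i
    by (simp add: that ldual_act_ldual_lact flip: direct_sum_invD(3)[OF z] ldual_act_lact)
  show ?thesis
    unfolding maps_from_power_def bimodule_maps_def
    by (auto simp: mem lact ldual_act_plus sum.distrib ldual_act_mult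
        additive_sum[of "lact C _", OF l_add_right]
        additive_sum[of "\<lambda>c. ldual_act C c _", OF ldual_act_add])
qed

lemma j_mem_j_tilde_image:
  assumes "i \<in> I"
  shows "(\<lambda>d. j d i y) \<in> j_tilde I j ` direct_sum I UNIV"
proof
  let ?w = "\<lambda>k. if k = i then y else 0"
  show "?w \<in> direct_sum I UNIV"
    using assms by (auto simp: direct_sum_def direct_product_def)
  \<comment> \<open>For y = 0 the support is empty, and both sides vanish by
    \<open>j_zero\<close>.\<close>
  have "{k \<in> I. ?w k \<noteq> 0} = (if y = 0 then {} else {i})"
    using assms by auto
  then show "(\<lambda>d. j d i y) = j_tilde I j ?w"
    by (auto simp: j_tilde_def j_zero)
qed

text \<open>Expanding the comultiplication of z_i turns z_i \<cdot> j_i(c) into a sum of terms x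
  j_i(c)(y). The first legs x serve as generators and the maps d \<mapsto> j_i(d)(y) as functionals;
  both are independent of c.\<close>

lemma right_locally_projective_j_tilde:
  assumes "\<And>N. finite N \<Longrightarrow> \<exists>z\<in>direct_sum I (coring_inv C \<phi>).
    \<forall>c\<in>N. c = (\<Sum>i\<in>{i\<in>I. z i \<noteq> 0}. ldual_act C (z i) (j c i))"
  shows "right_locally_projective (ract C) (j_tilde I j ` direct_sum I UNIV)"
  unfolding right_locally_projective_def
proof (intro allI impI)
  fix N :: "'c set" assume "finite N"
  then obtain z where z: "z \<in> direct_sum I (coring_inv C \<phi>)"
    and exp: "\<And>c. c \<in> N \<Longrightarrow> c = (\<Sum>i\<in>{i\<in>I. z i \<noteq> 0}. ldual_act C (z i) (j c i))"
    using assms by blast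
  define J where "J = {i\<in>I. z i \<noteq> 0}"
  have "finite J" using z by (auto simp: J_def direct_sum_def)
  \<comment> \<open>\<open>W\<close> collects the pairs of legs of every z_i, tagged with i; listing
    it numbers the generators and functionals.\<close>
  define W where "W = (\<Sum>i\<in>J. image_mset (\<lambda>(x, y). (i, x, y)) (SOME S. S \<in> comult C (z i)))"
  obtain ts where ts: "mset ts = W" using ex_mset by blast
  have "set_mset W \<subseteq> {t. fst t \<in> I}"
    using \<open>finite J\<close> by (auto simp: W_def J_def set_mset_sum)
  then have I: "fst (ts ! k) \<in> I" if "k < length ts" for k
    using that ts by (metis mem_Collect_eq nth_mem set_mset_mset subsetD)
  have "c = (\<Sum>k<length ts. ract C (fst (snd (ts ! k))) (j c (fst (ts ! k)) (snd (snd (ts ! k)))))"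
    if "c \<in> N" for c
  proof -
    have "c = (\<Sum>i\<in>J. ldual_act C (z i) (j c i))" unfolding J_def by (rule exp[OF that])
    also have "\<dots> = (\<Sum>(i, x, y)\<in>#W. ract C x (j c i y))"
      by (simp add: ldual_act_expansion W_def sum_mset_sum case_prod_unfold
          image_mset.compositionality o_def)
    also have "\<dots> = sum_list (map (\<lambda>(i, x, y). ract C x (j c i y)) ts)"
      by (simp flip: ts sum_mset_sum_list)
    also have "\<dots> = (\<Sum>k<length ts.
        ract C (fst (snd (ts ! k))) (j c (fst (ts ! k)) (snd (snd (ts ! k)))))"
      by (simp add: sum_list_sum_nth atLeast0LessThan case_prod_unfold)
    finally show ?thesis .
  qed
  then have "\<forall>x\<in>N. x = (\<Sum>k<length ts.
      ract C (fst (snd (ts ! k))) (j x (fst (ts ! k)) (snd (snd (ts ! k)))))" by blast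
  moreover have "\<forall>k<length ts.
      (\<lambda>d. j d (fst (ts ! k)) (snd (snd (ts ! k)))) \<in> j_tilde I j ` direct_sum I UNIV"
    using j_mem_j_tilde_image I by blast
  ultimately show "\<exists>(n::nat) e f. (\<forall>i<n. f i \<in> j_tilde I j ` direct_sum I UNIV) \<and>
      (\<forall>x\<in>N. x = (\<Sum>i<n. ract C (e i) (f i x)))"
    by (intro exI[of _ "length ts"] exI[of _ "\<lambda>k. fst (snd (ts ! k))"]
        exI[of _ "\<lambda>k d. j d (fst (ts ! k)) (snd (snd (ts ! k)))"] conjI)
qed

end

section \<open>Equivalence of the conditions and their consequences\<close>

theorem theorem5p3:
  fixes \<iota> :: "'k::{comm_ring,monoid_mult} \<Rightarrow> 'a::{ring,monoid_mult}"
    and C :: "('a, 'c::ab_group_add) coring_data"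
    and \<phi> :: "'b::{ring,monoid_mult} \<Rightarrow> 'a"
    and I :: "'i set"
    and j :: "'c \<Rightarrow> 'i \<Rightarrow> 'c \<Rightarrow> 'a"
  assumes "coring \<iota> C"
    and "left_locally_projective (lact C) (ldual C)"
    and "ring_morphism \<phi>"
    and "j \<in> maps_into_power C I"
  shows "let conditions =
      [ \<comment> \<open>(i)\<close>
        \<forall>N f. finite N \<and> f \<in> rdual_inv C \<phi> \<longrightarrow>
          (\<exists>g \<in> im_j_tilde_inv C \<phi> I j. \<forall>c\<in>N. g c = f c),
        \<comment> \<open>(ii)\<close>
        \<forall>N. finite N \<longrightarrow>
          (\<exists>e \<in> im_j_tilde_inv C \<phi> I j. \<forall>c\<in>N. e c = counit C c),
        \<comment> \<open>(iii)\<close>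
        \<forall>N f. finite N \<and> f \<in> rdual_inv C \<phi> \<longrightarrow>
          (\<exists>g \<in> im_j_tilde_inv C \<phi> I j. \<forall>c\<in>N. rdual_act C f c = rdual_act C g c),
        \<comment> \<open>(iv)\<close>
        \<forall>N. finite N \<longrightarrow>
          (\<exists>e \<in> im_j_tilde_inv C \<phi> I j. \<forall>c\<in>N. rdual_act C e c = c),
        \<comment> \<open>(v)\<close>
        \<forall>N. finite N \<longrightarrow>
          (\<exists>h \<in> maps_into_sum C \<phi> I. \<forall>f\<in>rdual C. \<forall>c\<in>N. j_tilde I j (h f) c = f c),
        \<comment> \<open>(vi)\<close>
        \<forall>N. finite N \<longrightarrow>
          (\<exists>z \<in> direct_sum I (coring_inv C \<phi>).
             \<forall>c\<in>N. c = (\<Sum>i\<in>{i\<in>I. z i \<noteq> 0}. ldual_act C (z i) (j c i))) ]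
    in (\<forall>P\<in>set conditions. \<forall>Q\<in>set conditions. P \<longleftrightarrow> Q) \<and>
       ((\<exists>P\<in>set conditions. P) \<longrightarrow>
          (\<forall>N. finite N \<longrightarrow> (\<exists>h \<in> maps_from_power C \<phi> I. \<forall>c\<in>N. c = h (j c))) \<and>
          inj j \<and>
          right_locally_projective (ract C) (j_tilde I j ` direct_sum I UNIV))"
proof -
  interpret coring_map_into_power \<iota> C I j \<phi>
    using assms(1,2,4) by (simp add: coring_map_into_power_def coring_map_into_power_axioms_def)
  define P1 where "P1 \<longleftrightarrow> (\<forall>N f. finite N \<and> f \<in> rdual_inv C \<phi> \<longrightarrow>
    (\<exists>g \<in> im_j_tilde_inv C \<phi> I j. \<forall>c\<in>N. g c = f c))"
  define P2 where "P2 \<longleftrightarrow> (\<forall>N. finite N \<longrightarrow>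
    (\<exists>e \<in> im_j_tilde_inv C \<phi> I j. \<forall>c\<in>N. e c = counit C c))"
  define P3 where "P3 \<longleftrightarrow> (\<forall>N f. finite N \<and> f \<in> rdual_inv C \<phi> \<longrightarrow>
    (\<exists>g \<in> im_j_tilde_inv C \<phi> I j. \<forall>c\<in>N. rdual_act C f c = rdual_act C g c))"
  define P4 where "P4 \<longleftrightarrow> (\<forall>N. finite N \<longrightarrow>
    (\<exists>e \<in> im_j_tilde_inv C \<phi> I j. \<forall>c\<in>N. rdual_act C e c = c))"
  define P5 where "P5 \<longleftrightarrow> (\<forall>N. finite N \<longrightarrow>
    (\<exists>h \<in> maps_into_sum C \<phi> I. \<forall>f\<in>rdual C. \<forall>c\<in>N. j_tilde I j (h f) c = f c))"
  define P6 where "P6 \<longleftrightarrow> (\<forall>N. finite N \<longrightarrow>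
    (\<exists>z \<in> direct_sum I (coring_inv C \<phi>).
      \<forall>c\<in>N. c = (\<Sum>i\<in>{i\<in>I. z i \<noteq> 0}. ldual_act C (z i) (j c i))))"
  have rdual: "e \<in> rdual C" if "e \<in> im_j_tilde_inv C \<phi> I j" for e
    using that j_tilde_rdual by (auto simp: im_j_tilde_inv_def)
  have P13: P3 if P1
    unfolding P3_def
  proof (intro allI impI)
    fix N :: "'c set" and f assume f: "finite N \<and> f \<in> rdual_inv C \<phi>"
    \<comment> \<open>Condition (i) is applied to a finite set \<open>M\<close> on which the values
      of a functional determine its action on \<open>N\<close>.\<close>
    obtain M where "finite M" and
      M: "\<And>f g :: 'c \<Rightarrow> 'a. \<forall>x\<in>M. f x = g x \<Longrightarrow> \<forall>c\<in>N. rdual_act C f c = rdual_act C g c"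
      using rdual_act_finite_dependence[of N] f by blast
    obtain g where "g \<in> im_j_tilde_inv C \<phi> I j" "\<forall>x\<in>M. g x = f x"
      using \<open>P1\<close> f \<open>finite M\<close> unfolding P1_def by blast
    then show "\<exists>g\<in>im_j_tilde_inv C \<phi> I j. \<forall>c\<in>N. rdual_act C f c = rdual_act C g c"
      using M[of f g] by auto
  qed
  have P34: P4 if P3
    unfolding P4_def
  proof (intro allI impI)
    fix N :: "'c set" assume "finite N"
    \<comment> \<open>Condition (iii) for f = \<epsilon>, which is B-invariant and acts as the
      identity.\<close>
    then obtain g where "g \<in> im_j_tilde_inv C \<phi> I j"
      "\<forall>c\<in>N. rdual_act C (counit C) c = rdual_act C g c"
      using \<open>P3\<close>[unfolded P3_def] counit_rdual_inv[of \<phi>] by blast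
    then show "\<exists>e\<in>im_j_tilde_inv C \<phi> I j. \<forall>c\<in>N. rdual_act C e c = c"
      unfolding rdual_act_counit eq_commute[of "rdual_act C _ _"] by blast
  qed
  have P42: P2 if P4
    unfolding P2_def
  proof (intro allI impI)
    fix N :: "'c set" assume "finite N"
    then obtain e where e: "e \<in> im_j_tilde_inv C \<phi> I j" "\<forall>c\<in>N. rdual_act C e c = c"
      using \<open>P4\<close> unfolding P4_def by blast
    then show "\<exists>e\<in>im_j_tilde_inv C \<phi> I j. \<forall>c\<in>N. e c = counit C c"
    proof (intro bexI[of _ e] ballI)
      fix c assume "c \<in> N"
      \<comment> \<open>Applying \<epsilon> to e \<cdot> c = c gives e(c) = \<epsilon>(c).\<close>
      then show "e c = counit C c" using counit_rdual_act[OF rdual[OF e(1)], of c] e(2) by simp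
    qed
  qed
  have P24: P4 if P2
    unfolding P4_def
  proof (intro allI impI)
    fix N :: "'c set" assume "finite N"
    then obtain M where "finite M" and
      M: "\<And>f g :: 'c \<Rightarrow> 'a. \<forall>x\<in>M. f x = g x \<Longrightarrow> \<forall>c\<in>N. rdual_act C f c = rdual_act C g c"
      using rdual_act_finite_dependence[of N] by blast
    obtain e where "e \<in> im_j_tilde_inv C \<phi> I j" "\<forall>x\<in>M. e x = counit C x"
      using \<open>P2\<close> \<open>finite M\<close> unfolding P2_def by blast
    then show "\<exists>e\<in>im_j_tilde_inv C \<phi> I j. \<forall>c\<in>N. rdual_act C e c = c"
      using M[of e "counit C"] by (auto simp: rdual_act_counit)
  qed
  have P46: "P4 \<longleftrightarrow> P6"
    unfolding P4_def P6_def im_j_tilde_inv_def direct_sum_inv_eq bex_simps(7) rdual_act_j_tilde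
    by (simp only: eq_commute)
  have P41: P1 if P4
    unfolding P1_def
  proof (intro allI impI)
    fix N :: "'c set" and f assume N: "finite N \<and> f \<in> rdual_inv C \<phi>"
    then obtain z where z: "z \<in> direct_sum_inv C \<phi> I"
      and e: "\<forall>c\<in>N. rdual_act C (j_tilde I j z) c = c"
      using \<open>P4\<close> unfolding P4_def im_j_tilde_inv_def by blast
    have f: "f \<in> rdual C" using N by (simp add: rdual_inv_def invariants_def)
    \<comment> \<open>The witness j~(f \<cdot> z) takes at c the value f(j~(z) \<cdot> c) =
      f(c).\<close>
    have "\<forall>c\<in>N. j_tilde I j (\<lambda>i. rdual_act C f (z i)) c = f c"
      using e by (simp add: j_tilde_rdual_act[OF f] direct_sum_invD(1)[OF z])
    moreover have "j_tilde I j (\<lambda>i. rdual_act C f (z i)) \<in> im_j_tilde_inv C \<phi> I j"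
      unfolding im_j_tilde_inv_def
      by (rule imageI, rule rdual_act_direct_sum_inv[OF conjunct2[OF N] z])
    ultimately show "\<exists>g\<in>im_j_tilde_inv C \<phi> I j. \<forall>c\<in>N. g c = f c" by (rule bexI)
  qed
  have P45: P5 if P4
    unfolding P5_def
  proof (intro allI impI)
    fix N :: "'c set" assume "finite N"
    then obtain z where z: "z \<in> direct_sum_inv C \<phi> I"
      and e: "\<forall>c\<in>N. rdual_act C (j_tilde I j z) c = c"
      using \<open>P4\<close> unfolding P4_def im_j_tilde_inv_def by blast
    have "\<forall>f\<in>rdual C. \<forall>c\<in>N. j_tilde I j (\<lambda>i. rdual_act C f (z i)) c = f c"
      using e by (simp add: j_tilde_rdual_act direct_sum_invD(1)[OF z])
    then show "\<exists>h\<in>maps_into_sum C \<phi> I. \<forall>f\<in>rdual C. \<forall>c\<in>N. j_tilde I j (h f) c = f c"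
      by (rule bexI[OF _ local_right_inverse_mem[OF z]])
  qed
  have P52: P2 if P5
    unfolding P2_def
  proof (intro allI impI)
    fix N :: "'c set" assume "finite N"
    then obtain h where "h \<in> maps_into_sum C \<phi> I"
      and h: "\<forall>f\<in>rdual C. \<forall>c\<in>N. j_tilde I j (h f) c = f c"
      using \<open>P5\<close> unfolding P5_def by blast
    \<comment> \<open>The witness for (ii) is j~(h(\<epsilon>)), admissible because h(\<epsilon>) is
      an invariant family.\<close>
    then have "j_tilde I j (h (counit C)) \<in> im_j_tilde_inv C \<phi> I j"
      unfolding im_j_tilde_inv_def by (intro imageI invariant_of_map_into_sum)
    with h counit_rdual show "\<exists>e\<in>im_j_tilde_inv C \<phi> I j. \<forall>c\<in>N. e c = counit C c"
      by blast
  qed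
  have a: "\<forall>N. finite N \<longrightarrow> (\<exists>h \<in> maps_from_power C \<phi> I. \<forall>c\<in>N. c = h (j c))" if P6
  proof (intro allI impI)
    fix N :: "'c set" assume "finite N"
    then obtain z where "z \<in> direct_sum_inv C \<phi> I"
      "\<forall>c\<in>N. c = (\<Sum>i\<in>{i\<in>I. z i \<noteq> 0}. ldual_act C (z i) (j c i))"
      using \<open>P6\<close> unfolding P6_def direct_sum_inv_eq by blast
    then show "\<exists>h\<in>maps_from_power C \<phi> I. \<forall>c\<in>N. c = h (j c)"
      by (intro bexI[OF _ local_left_inverse_mem])
  qed
  have b: "inj j" if P6
  proof (rule injI)
    fix c d assume "j c = j d"
    \<comment> \<open>One local left inverse is taken for both elements at once.\<close>
    moreover obtain h where "c = h (j c)" "d = h (j d)"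
      using a[OF \<open>P6\<close>, rule_format, of "{c, d}"] by blast
    ultimately show "c = d" by metis
  qed
  have c: "right_locally_projective (ract C) (j_tilde I j ` direct_sum I UNIV)" if P6
    using that right_locally_projective_j_tilde unfolding P6_def by blast
  \<comment> \<open>The cycle is (i), (iii), (iv), (i); moreover (ii) and (iv) imply each other,
    (iv) gives (v), (v) gives (ii), and (iv) is equivalent to (vi).\<close>
  have eq: "P1 \<longleftrightarrow> P6" "P2 \<longleftrightarrow> P6" "P3 \<longleftrightarrow> P6" "P4 \<longleftrightarrow> P6" "P5 \<longleftrightarrow> P6"
    using P13 P34 P42 P24 P46 P41 P45 P52 by blast+
  show ?thesis
    unfolding Let_def P1_def[symmetric] P2_def[symmetric] P3_def[symmetric] P4_def[symmetric]
      P5_def[symmetric] P6_def[symmetric] eq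
    using a b c by simp
qed

end
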